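(* Let $\mathcal{P}$ be the set of all primes. Every subset of $\mathcal{P}$ of positive upper density (relative to $\mathcal{P}$) linearly admits a 4-cycle.
   Context: The upper density of $A\subseteq\mathcal{P}$ relative to the primes is $\limsup_{N\to\infty}|A\cap[1,N]|/|\mathcal{P}\cap[1,N]|$. A (possibly infinite) set of primes $A$ linearly admits a 4-cycle if there exist signs $\epsilon_1,\epsilon_2,\epsilon_3,\epsilon_4\in\{-1,1\}$ and positive integers $u_1,u_2,u_3,u_4$, each of which is a product of finitely many pairwise distinct primes from $A$ (the empty product $1$ being allowed), such that $\epsilon_1u_1+\epsilon_2u_2+\epsilon_3u_3+\epsilon_4u_4=0$ and no proper nonempty subsum vanishes (i.e. $\sum_{i\in I}\epsilon_iu_i\neq 0$ for every $\emptyset\ne I\subsetneq\{1,2,3,4\}$). The $u_i$ need not be distinct. *)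

theory Defs
  imports "HOL-Analysis.Analysis" "HOL-Computational_Algebra.Primes"
begin

definition primes :: "nat set" where
  "primes = {p. prime p}"

(* At N = 0, 1 the quotient is 0 / 0 = 0, which does not affect the limsup. *)
definition upper_prime_density :: "nat set \<Rightarrow> ereal" where
  "upper_prime_density A =
     limsup (\<lambda>N::nat. ereal (real (card (A \<inter> {1..N})) / real (card (primes \<inter> {1..N}))))"

definition distinct_products :: "nat set \<Rightarrow> nat set" where
  "distinct_products A = {\<Prod>S | S. finite S \<and> S \<subseteq> A}"

definition linearly_admits_4_cycle :: "nat set \<Rightarrow> bool" where
  "linearly_admits_4_cycle A \<longleftrightarrow>
     (\<exists>(\<epsilon> :: nat \<Rightarrow> int) (u :: nat \<Rightarrow> nat).
        (\<forall>i\<in>{1..4}. \<epsilon> i \<in> {-1, 1}) \<and>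
        (\<forall>i\<in>{1..4}. u i \<in> distinct_products A) \<and>
        (\<Sum>i\<in>{1..4}. \<epsilon> i * int (u i)) = 0 \<and>
        (\<forall>I. I \<noteq> {} \<and> I \<subset> {1..4} \<longrightarrow> (\<Sum>i\<in>I. \<epsilon> i * int (u i)) \<noteq> 0))"

end

theory Submission
  imports Defs "HOL-Real_Asymp.Real_Asymp"
begin

text \<open>
  The sums \<open>p + q\<close> of elements of \<open>A\<close> up to \<open>N\<close> cannot be pairwise distinct once
  \<open>|A \<inter> [1, N]|\<^sup>2\<close> is large compared with \<open>N\<close>. If \<open>A\<close> has positive upper density, this happens for
  some \<open>N\<close> by Chebyshev's lower bound \<open>\<pi>(N) \<gg> N / ln N\<close>, and the resulting relation
  \<open>p + q' = p' + q\<close> is a 4-cycle whose terms are primes of \<open>A\<close>. Chebyshev's bound follows from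
  the fact that the central binomial coefficient \<open>2n choose n\<close> divides the least common multiple of
  \<open>1, \<dots>, 2n\<close>, whose prime power factors are all at most \<open>2n\<close>.
\<close>

section \<open>Chebyshev's lower bound for the number of primes\<close>

text \<open>
  The recurrence of Leibniz's harmonic triangle, \<open>L(n + 1, m + 1) = L(n, m) - L(n + 1, m)\<close> for
  \<open>L(n, m) = 1 / (m (n choose m))\<close>, propagates integrality of \<open>d L(n, m)\<close> from
  \<open>m = 1\<close> to all \<open>m\<close>.
\<close>

lemma times_binomial_dvd_common_multiple:
  fixes d n m :: nat
  assumes dvd: "\<And>k. 1 \<le> k \<Longrightarrow> k \<le> n \<Longrightarrow> k dvd d"
    and "1 \<le> m" "m \<le> n"
  shows "m * (n choose m) dvd d"
proof -
  have "real d / real (m * (n choose m)) \<in> \<int>"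
    using assms(2,3) dvd
  proof (induction m arbitrary: n rule: dec_induct)
    case base
    then have "n dvd d" by auto
    then show ?case by (auto simp: dvd_def)
  next
    case (step m)
    obtain n' where n: "n = Suc n'" using step.prems by (cases n) auto
    with step have m: "1 \<le> m" "m \<le> n'" and mn: "m \<le> n" by auto
    define b where "b = real (n choose m)"
    have b: "b > 0" using mn by (simp add: b_def zero_less_binomial_iff)
    have r: "real n - real m > 0" using m n by simp
    have absorb1: "real (Suc m) * real (n choose Suc m) = (real n - real m) * b"
    proof -
      have "Suc m * (n choose Suc m) = (n - m) * (n choose m)"
        by (simp only: binomial_absorption binomial_absorb_comp)
      then have "real (Suc m * (n choose Suc m)) = real ((n - m) * (n choose m))" by simp
      then show ?thesis using mn by (simp only: b_def of_nat_mult of_nat_diff)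
    qed
    have absorb2: "real n * real (n' choose m) = (real n - real m) * b"
    proof -
      have "(n - m) * (n choose m) = n * (n' choose m)"
        using n binomial_absorb_comp[of n m] by simp
      then have "real ((n - m) * (n choose m)) = real (n * (n' choose m))" by simp
      then show ?thesis using mn by (simp only: b_def of_nat_mult of_nat_diff)
    qed
    have quot: "real (n' choose m) = (real n - real m) * b / real n"
      using absorb2 n by (simp add: field_simps)
    \<comment> \<open>Leibniz's recurrence in row \<open>n = n' + 1\<close>. One term lies in row
      \<open>n'\<close>, the other in row \<open>n\<close>, so the induction on \<open>m\<close>
      must keep \<open>n\<close> arbitrary.\<close>
    have eq: "real d / real (Suc m * (n choose Suc m)) =
        real d / real (m * (n' choose m)) - real d / real (m * (n choose m))"
      unfolding of_nat_mult absorb1 quot b_def[symmetric]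
      using b r m n by (simp add: divide_simps) (simp add: algebra_simps)
    show ?case
      unfolding eq using m n by (intro Ints_diff step.IH step.prems) auto
  qed
  then obtain z where "real d / real (m * (n choose m)) = of_int z"
    by (auto elim: Ints_cases)
  moreover have "m * (n choose m) > 0" using assms by simp
  ultimately have "real_of_int (int d) = of_int (int (m * (n choose m)) * z)"
    by (simp add: field_simps)
  then have "int d = int (m * (n choose m)) * z" by (simp only: of_int_eq_iff)
  then have "int (m * (n choose m)) dvd int d" by (rule dvdI)
  then show ?thesis by (simp only: int_dvd_int_iff)
qed

text \<open>The witness is the least common multiple of \<open>1, ..., N\<close>, built as the
  product over the primes \<open>p\<close> up to \<open>N\<close> of the largest power of
  \<open>p\<close> not exceeding \<open>N\<close>.\<close>

lemma ex_common_multiple_le_power_card_primes: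
  fixes N :: nat
  shows "\<exists>d. 0 < d \<and> d \<le> N ^ card (primes \<inter> {1..N}) \<and> (\<forall>k. 1 \<le> k \<longrightarrow> k \<le> N \<longrightarrow> k dvd d)"
proof (cases "N = 0")
  case True
  then show ?thesis by (intro exI[of _ 1]) auto
next
  case False
  define P where "P = primes \<inter> {1..N}"
  \<comment> \<open>Collecting the powers rather than the exponents keeps \<open>Q p\<close> finite
    for every \<open>p\<close>, even 0 and 1, so \<open>Max (Q p)\<close> needs no
    primality.\<close>
  define Q where "Q p = {q. (\<exists>e. q = p ^ e) \<and> q \<le> N}" for p :: nat
  define d where "d = (\<Prod>p\<in>P. Max (Q p))"
  have fin: "finite (Q p)" for p
    by (rule finite_subset[of _ "{..N}"]) (auto simp: Q_def)
  have one: "1 \<in> Q p" for p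
    using False by (auto simp: Q_def intro: exI[of _ 0])
  have Max_in: "Max (Q p) \<in> Q p" for p
    using fin one by (intro Max_in) auto
  have "0 < Max (Q p)" for p
    using Max_ge[OF fin one, of p] by simp
  then have "0 < d"
    unfolding d_def by (intro prod_pos) simp
  moreover have "d \<le> N ^ card P"
    unfolding d_def by (rule prod_le_power) (use Max_in False in \<open>auto simp: Q_def\<close>)
  moreover have "k dvd d" if k: "1 \<le> k" "k \<le> N" for k
  proof -
    have sub: "prime_factors k \<subseteq> P"
    proof
      fix p assume "p \<in> prime_factors k"
      then have "prime p" "p dvd k" by auto
      then show "p \<in> P"
        using k dvd_imp_le[of p k] prime_ge_1_nat[of p] by (auto simp: P_def primes_def)
    qed
    have "k = (\<Prod>p\<in>prime_factors k. p ^ multiplicity p k)"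
      using k prime_factorization_nat[of k] by simp
    also have "\<dots> dvd (\<Prod>p\<in>prime_factors k. Max (Q p))"
    proof (rule prod_dvd_prod)
      fix p assume p: "p \<in> prime_factors k"
      then have "prime p" by auto
      have "p ^ multiplicity p k \<le> k"
        using k by (intro dvd_imp_le multiplicity_dvd) auto
      then have "p ^ multiplicity p k \<in> Q p"
        using k by (auto simp: Q_def)
      then have le: "p ^ multiplicity p k \<le> Max (Q p)"
        using fin by (intro Max_ge)
      obtain e where e: "Max (Q p) = p ^ e"
        using Max_in[of p] by (auto simp: Q_def)
      have "multiplicity p k \<le> e"
        using le prime_gt_1_nat[OF \<open>prime p\<close>] unfolding e by (simp add: power_increasing_iff)
      then show "p ^ multiplicity p k dvd Max (Q p)"
        unfolding e by (rule le_imp_power_dvd)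
    qed
    also have "\<dots> dvd d"
      unfolding d_def using sub by (intro prod_dvd_prod_subset) (auto simp: P_def)
    finally show ?thesis .
  qed
  ultimately show ?thesis by (auto simp: P_def)
qed

text \<open>Take logarithms in \<open>4 ^ n \<le> 2 * n * (2 * n choose n)\<close> with
  \<open>n = N div 2\<close>. The term \<open>N - 1\<close> allows for odd \<open>N\<close>.\<close>

lemma Chebyshev_lower_bound:
  fixes N :: nat
  assumes "2 \<le> N"
  shows "(real N - 1) * ln 2 / ln (real N) - 1 \<le> real (card (primes \<inter> {1..N}))"
proof -
  define n where "n = N div 2"
  have n: "1 \<le> n" "2 * n \<le> N" "N - 1 \<le> 2 * n" using assms by (auto simp: n_def)
  obtain d where d: "0 < d" "d \<le> N ^ card (primes \<inter> {1..N})"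
    and dvd: "\<And>k. 1 \<le> k \<Longrightarrow> k \<le> N \<Longrightarrow> k dvd d"
    using ex_common_multiple_le_power_card_primes by blast
  have "n * (2 * n choose n) dvd d"
    using n by (intro times_binomial_dvd_common_multiple dvd) auto
  then have "n * (2 * n choose n) \<le> d"
    using d by (intro dvd_imp_le)
  then have "(2 * n choose n) \<le> N ^ card (primes \<inter> {1..N})"
    using mult_le_mono1[OF n(1), of "2 * n choose n"] d(2) by linarith
  then have "real (2 * n choose n) \<le> real N ^ card (primes \<inter> {1..N})"
    by (metis of_nat_le_iff of_nat_power)
  moreover have "4 ^ n / (2 * real n) \<le> real (2 * n choose n)"
    using n by (intro central_binomial_lower_bound) simp
  then have "4 ^ n \<le> 2 * real n * real (2 * n choose n)"
    using n by (simp add: field_simps)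
  ultimately have "4 ^ n \<le> 2 * real n * real N ^ card (primes \<inter> {1..N})"
    by (meson mult_left_mono of_nat_0_le_iff order_trans zero_le_mult_iff zero_le_numeral)
  also have "\<dots> \<le> real N * real N ^ card (primes \<inter> {1..N})"
    using n by (intro mult_right_mono) auto
  \<comment> \<open>The factor \<open>2 * n\<close>, at most \<open>N\<close>, costs one more power
    of \<open>N\<close>: this is the final \<open>- 1\<close> of the bound.\<close>
  finally have "(2::real) ^ (2 * n) \<le> real N ^ Suc (card (primes \<inter> {1..N}))"
    by (simp add: power_mult)
  then have "ln ((2::real) ^ (2 * n)) \<le> ln (real N ^ Suc (card (primes \<inter> {1..N})))"
    using assms by (subst ln_le_cancel_iff) auto
  then have "real (2 * n) * ln 2 \<le> real (Suc (card (primes \<inter> {1..N}))) * ln (real N)"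
    using assms by (simp only: ln_realpow)
  moreover have "(real N - 1) * ln 2 \<le> real (2 * n) * ln 2"
    using n by (intro mult_right_mono) auto
  ultimately show ?thesis
    using assms by (simp add: field_simps)
qed

lemma eventually_card_primes_ge_sqrt:
  fixes C :: real
  shows "eventually (\<lambda>N. C * sqrt (real N) \<le> real (card (primes \<inter> {1..N}))) sequentially"
proof -
  have "eventually (\<lambda>N. C * sqrt (real N) \<le> (real N - 1) * ln 2 / ln (real N) - 1) sequentially"
    by real_asymp
  moreover have "eventually (\<lambda>N. 2 \<le> N) sequentially"
    by (rule eventually_ge_at_top)
  ultimately show ?thesis
    by eventually_elim (use Chebyshev_lower_bound order_trans in blast)
qed

section \<open>From equal differences to a 4-cycle\<close>

text \<open>Pigeonhole: the ordered pairs of distinct elements of \<open>B\<close> outnumber the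
  \<open>2 * N + 1\<close> integers in \<open>[-N, N]\<close>, where their differences lie. If two
  different pairs share a difference, their first entries differ, since otherwise the second entries
  would agree too.\<close>

lemma ex_equal_differences:
  fixes B :: "nat set"
  assumes sub: "B \<subseteq> {1..N}" and card: "2 * N + 1 < card B * (card B - 1)"
  obtains p q p' q' where "p \<in> B" "q \<in> B" "p' \<in> B" "q' \<in> B"
    "p \<noteq> q" "p \<noteq> p'" "p + q' = p' + q"
proof -
  define f where "f = (\<lambda>(p, q). int p - int q)"
  define D where "D = (SIGMA p:B. B - {p})"
  have fin: "finite B" using sub finite_subset by blast
  have "card D = (\<Sum>p\<in>B. card (B - {p}))"
    unfolding D_def using fin by (intro card_SigmaI) auto
  also have "\<dots> = card B * (card B - 1)"
    using fin by simp
  finally have cD: "card D = card B * (card B - 1)" .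
  have "f ` D \<subseteq> {- int N..int N}"
    using sub by (fastforce simp: f_def D_def)
  then have "card (f ` D) \<le> card {- int N..int N}"
    by (rule card_mono[rotated]) simp
  also have "\<dots> < card D"
    using cD card by simp
  finally have "\<not> inj_on f D"
    by (rule pigeonhole)
  then obtain p q p' q' where "(p, q) \<in> D" "(p', q') \<in> D" "(p, q) \<noteq> (p', q')"
      "f (p, q) = f (p', q')"
    unfolding inj_on_def by fast
  then show thesis
    by (intro that[of p q p' q']) (auto simp: f_def D_def)
qed

lemma mem_distinct_products: "p \<in> A \<Longrightarrow> p \<in> distinct_products A"
  by (auto simp: distinct_products_def intro!: exI[of _ "{p}"])

text \<open>In \<open>p + q' - p' - q = 0\<close>, singletons do not vanish by positivity, nor do
  triples, being complements of singletons. Pairs of equal sign are nonzero; those of opposite sign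
  equal \<open>p - p'\<close> or \<open>p - q\<close> up to sign.\<close>

lemma linearly_admits_4_cycleI:
  assumes mem: "p \<in> A" "q \<in> A" "p' \<in> A" "q' \<in> A"
    and pos: "0 < p" "0 < q" "0 < p'" "0 < q'"
    and ne: "p \<noteq> q" "p \<noteq> p'"
    and eq: "p + q' = p' + q"
  shows "linearly_admits_4_cycle A"
proof -
  define e :: "nat \<Rightarrow> int" where "e i = (if i \<le> 2 then 1 else -1)" for i
  define u :: "nat \<Rightarrow> nat" where
    "u i = (if i = 1 then p else if i = 2 then q' else if i = 3 then p' else q)" for i
  have set4: "{1..4} = {1, 2, 3, 4::nat}" by auto
  have ints: "int p + int q' = int p' + int q"
    using eq by linarith
  have "(\<Sum>i\<in>I. e i * int (u i)) \<noteq> 0" if I: "I \<noteq> {}" "I \<subset> {1..4}" for I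
  proof -
    have "(\<Sum>i\<in>I. e i * int (u i)) = (\<Sum>i\<in>{1..4}. if i \<in> I then e i * int (u i) else 0)"
      using I(2) sum.inter_restrict[of "{1..4}" "\<lambda>i. e i * int (u i)" I]
      by (simp add: Int_absorb1 psubset_imp_subset)
    also have "\<dots> = (if 1 \<in> I then int p else 0) + (if 2 \<in> I then int q' else 0)
        - (if 3 \<in> I then int p' else 0) - (if 4 \<in> I then int q else 0)"
      unfolding set4 by (simp add: e_def u_def)
    also have "\<dots> \<noteq> 0"
    proof -
      have "1 \<in> I \<or> 2 \<in> I \<or> 3 \<in> I \<or> 4 \<in> I" "\<not> (1 \<in> I \<and> 2 \<in> I \<and> 3 \<in> I \<and> 4 \<in> I)"
        using I unfolding set4 by auto
      then show ?thesis
        using pos ne ints by (auto split: if_splits)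
    qed
    finally show ?thesis .
  qed
  moreover have "(\<Sum>i\<in>{1..4}. e i * int (u i)) = 0"
    using ints unfolding set4 by (simp add: e_def u_def)
  moreover have "\<forall>i\<in>{1..4}. u i \<in> distinct_products A"
    using mem by (auto simp: u_def intro: mem_distinct_products)
  moreover have "\<forall>i\<in>{1..4}. e i \<in> {-1, 1}"
    by (simp add: e_def)
  ultimately show ?thesis
    unfolding linearly_admits_4_cycle_def by blast
qed

section \<open>Positive upper density and the conclusion\<close>

lemma frequently_card_ge_of_upper_prime_density_pos:
  assumes "upper_prime_density A > 0"
  obtains c :: real where "0 < c" "\<exists>\<^sub>F N in sequentially.
    c * real (card (primes \<inter> {1..N})) \<le> real (card (A \<inter> {1..N}))"
proof -
  obtain c where c: "0 < ereal c" "ereal c < upper_prime_density A"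
    using ereal_dense2[OF assms] by blast
  have "\<exists>\<^sub>F N in sequentially.
      c * real (card (primes \<inter> {1..N})) \<le> real (card (A \<inter> {1..N}))"
  proof (rule ccontr)
    assume "\<not> ?thesis"
    then have "\<forall>\<^sub>F N in sequentially.
        real (card (A \<inter> {1..N})) < c * real (card (primes \<inter> {1..N}))"
      by (simp add: frequently_def not_le)
    then have "\<forall>\<^sub>F N in sequentially.
        ereal (real (card (A \<inter> {1..N})) / real (card (primes \<inter> {1..N}))) \<le> ereal c"
    proof eventually_elim
      case (elim N)
      \<comment> \<open>The strict inequality excludes a zero denominator, where the quotient would
        take its default value.\<close>
      then have "0 < real (card (primes \<inter> {1..N}))"
        using c(1) by (cases "card (primes \<inter> {1..N}) = 0") auto
      then show ?case using elim by (simp add: field_simps)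
    qed
    then have "upper_prime_density A \<le> ereal c"
      unfolding upper_prime_density_def by (rule Limsup_bounded)
    then show False using c(2) by simp
  qed
  then show thesis using c(1) by (intro that[of c]) simp_all
qed

theorem corollary2p7:
  fixes A :: "nat set"
  assumes "A \<subseteq> primes"
    and "upper_prime_density A > 0"
  shows "linearly_admits_4_cycle A"
proof -
  obtain c :: real where c: "0 < c" and freq: "\<exists>\<^sub>F N in sequentially.
      c * real (card (primes \<inter> {1..N})) \<le> real (card (A \<inter> {1..N}))"
    using frequently_card_ge_of_upper_prime_density_pos[OF assms(2)] by blast
  \<comment> \<open>The constant \<open>3 / c\<close> gives \<open>K \<ge> 3 * sqrt N\<close> below,
    hence \<open>K * (K - 1) \<ge> 9 * N - 3 * sqrt N \<ge> 6 * N > 2 * N + 1\<close>.\<close>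
  have "\<forall>\<^sub>F N in sequentially. 3 / c * sqrt (real N) \<le> real (card (primes \<inter> {1..N})) \<and> 1 \<le> N"
    by (intro eventually_conj eventually_card_primes_ge_sqrt eventually_ge_at_top)
  then obtain N where N: "1 \<le> N"
      "3 / c * sqrt (real N) \<le> real (card (primes \<inter> {1..N}))"
      "c * real (card (primes \<inter> {1..N})) \<le> real (card (A \<inter> {1..N}))"
    using frequently_ex[OF frequently_eventually_conj[OF freq]] by blast
  define K where "K = card (A \<inter> {1..N})"
  have "3 * sqrt (real N) = c * (3 / c * sqrt (real N))" using c by simp
  also have "\<dots> \<le> c * real (card (primes \<inter> {1..N}))" using N c by (intro mult_left_mono) auto
  finally have K: "3 * sqrt (real N) \<le> real K" using N by (simp add: K_def)
  have s: "1 \<le> sqrt (real N)" using N by simp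
  have "2 * real N + 1 < 3 * sqrt (real N) * (3 * sqrt (real N) - 1)"
  proof -
    have "sqrt (real N) * 1 \<le> sqrt (real N) * sqrt (real N)"
      using s by (intro mult_left_mono) auto
    moreover have "sqrt (real N) * sqrt (real N) = real N" by simp
    ultimately show ?thesis using N(1) unfolding right_diff_distrib mult.assoc by linarith
  qed
  also have "\<dots> \<le> real K * (real K - 1)"
    using K s by (intro mult_mono) linarith+
  also have "\<dots> = real (K * (K - 1))"
  proof -
    have "1 \<le> real K" using K s by linarith
    then show ?thesis by (simp add: of_nat_diff)
  qed
  finally have "real (2 * N + 1) < real (K * (K - 1))"
    by (simp only: of_nat_add of_nat_mult of_nat_numeral of_nat_1)
  then have "2 * N + 1 < K * (K - 1)" by (simp only: of_nat_less_iff)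
  then obtain p q p' q' where *: "p \<in> A \<inter> {1..N}" "q \<in> A \<inter> {1..N}" "p' \<in> A \<inter> {1..N}"
      "q' \<in> A \<inter> {1..N}" "p \<noteq> q" "p \<noteq> p'" "p + q' = p' + q"
    unfolding K_def by (rule ex_equal_differences[rotated]) auto
  show ?thesis
    by (rule linearly_admits_4_cycleI[of p A q p' q']) (use * in auto)
qed

end
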